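(* Let $f\in C^{1}[0,1]$ be real-valued and let $p\in(0,1)$. If ${}^{C}D_{1^{-}}^{r}f(t)\geq 0$ for all $t\in[0,1]$ and all $r\in(p,1)$, then $f$ is monotone decreasing on $[0,1]$. Similarly, if ${}^{C}D_{1^{-}}^{r}f(t)\leq 0$ for all $t\in[0,1]$ and all $r\in(p,1)$, then $f$ is monotone increasing on $[0,1]$.
   Context: For $0<r<1$, the right Caputo fractional derivative of order $r$ of $g\in C^1[0,1]$ is ${}^{C}D_{1^{-}}^{r}g(t)=-I_{1^{-}}^{1-r}g'(t)$, where for $\mu>0$ the right Riemann--Liouville fractional integral is $$I_{1^{-}}^{\mu}h(t)=\frac{1}{\Gamma(\mu)}\int_{t}^{1}\frac{h(s)}{(s-t)^{1-\mu}}\,ds.$$ "Monotone decreasing" and "monotone increasing" are meant in the non-strict sense. *)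

theory Defs
  imports "HOL-Analysis.Analysis"
begin

(* Derivative relative to [0,1], hence one-sided at 0 and 1: values outside [0,1] are irrelevant. *)
definition deriv_unit :: "(real \<Rightarrow> real) \<Rightarrow> real \<Rightarrow> real" where
  "deriv_unit g t = vector_derivative g (at t within {0..1})"

definition C1_unit :: "(real \<Rightarrow> real) \<Rightarrow> bool" where
  "C1_unit g \<longleftrightarrow> g differentiable_on {0..1} \<and> continuous_on {0..1} (deriv_unit g)"

(* Meant for mu > 0 and t in [0,1].  The value of the integrand at s = t is a convention
   (division by zero) that does not affect the integral. *)
definition right_RL_integral :: "real \<Rightarrow> (real \<Rightarrow> real) \<Rightarrow> real \<Rightarrow> real" where
  "right_RL_integral \<mu> h t =
     1 / Gamma \<mu> * (LINT s:{t..1}|lebesgue. h s / (s - t) powr (1 - \<mu>))"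

(* Meant for 0 < r < 1 and C^1 functions g. *)
definition right_Caputo_deriv :: "real \<Rightarrow> (real \<Rightarrow> real) \<Rightarrow> real \<Rightarrow> real" where
  "right_Caputo_deriv r g t = - right_RL_integral (1 - r) (deriv_unit g) t"

end

(* If h(t) > 0 for some t < 1, then h exceeds some e > 0 near t, and the part of the integral of
   h(s) (s - t)^(-r) near t is of order e / (1 - r), while the rest stays bounded as r tends to 1.
   Hence the fractional integral of order 1 - r is positive for r close to 1.  With h = f' and
   h = -f' this determines the sign of f'. *)
theory Submission
  imports Defs
begin

lemma has_integral_shifted_powr:
  fixes r t b :: real
  assumes "r < 1" "t \<le> b"
  shows "((\<lambda>s. (s - t) powr - r) has_integral ((b - t) powr (1 - r) / (1 - r))) {t..b}"
proof -
  have "((\<lambda>x. x powr - r) has_integral ((b - t) powr (- r + 1) / (- r + 1))) {0..b - t}"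
    using assms by (intro has_integral_powr_from_0) auto
  from has_integral_shift_real_ivl[OF this, of "- t"]
  show ?thesis by (simp add: add.commute)
qed

text \<open>With \<open>k\<close> the kernel, \<open>e * k s - (e + M) / d\<close> lies below
  \<open>h s * k s\<close> on all of [t,1], so the integral need not be split at
  \<open>t + d\<close>. The minorant integrates explicitly; the subtracted constant is independent
  of \<open>r\<close>, while \<open>e / (1 - r)\<close> blows up as \<open>r\<close> tends to
  1.\<close>

lemma integral_singular_kernel_ge:
  fixes h :: "real \<Rightarrow> real" and t r e M d :: real
  assumes h: "continuous_on {t..1} h" and t: "0 \<le> t" "t < 1" and r: "0 < r" "r < 1"
    and e: "0 < e" and d: "0 < d" "d \<le> 1"
    and near: "\<And>s. t \<le> s \<Longrightarrow> s < t + d \<Longrightarrow> s \<le> 1 \<Longrightarrow> e \<le> h s"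
    and M: "\<And>s. s \<in> {t..1} \<Longrightarrow> \<bar>h s\<bar> \<le> M"
  shows "(1 - t) * (e / (1 - r) - (e + M) / d) \<le> (LINT s:{t..1}|lebesgue. h s / (s - t) powr r)"
proof -
  define k where "k = (\<lambda>s. (s - t) powr - r)"
  have k: "(k has_integral ((1 - t) powr (1 - r) / (1 - r))) {t..1}"
    unfolding k_def using r t by (intro has_integral_shifted_powr) auto
  have k0: "0 \<le> k s" for s by (simp add: k_def)
  have M0: "0 \<le> M" using M[of t] t by auto
  \<comment> \<open>Domination by \<open>M * k\<close> gives absolute integrability, so the Lebesgue
    integral is a genuine value rather than the default 0, and it agrees with the gauge
    integral.\<close>
  have "k \<in> borel_measurable (lebesgue_on {t..1})"
    using k by (intro integrable_imp_measurable) auto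
  moreover have "h \<in> borel_measurable (lebesgue_on {t..1})"
    by (intro continuous_imp_measurable_on_sets_lebesgue h) auto
  ultimately have "(\<lambda>s. h s * k s) \<in> borel_measurable (lebesgue_on {t..1})"
    by (intro borel_measurable_times)
  moreover have "(\<lambda>s. M * k s) integrable_on {t..1}"
    using has_integral_mult_right[OF k] by blast
  moreover have "norm (h s * k s) \<le> M * k s" if "s \<in> {t..1}" for s
    using M[OF that] k0[of s] by (simp add: abs_mult mult_right_mono)
  ultimately have hk: "(\<lambda>s. h s * k s) absolutely_integrable_on {t..1}"
    by (intro measurable_bounded_by_integrable_imp_absolutely_integrable) auto
  have lower: "((\<lambda>s. e * k s - (e + M) / d) has_integral
      (e * ((1 - t) powr (1 - r) / (1 - r)) - (1 - t) * ((e + M) / d))) {t..1}"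
    using t has_integral_diff[OF has_integral_mult_right[OF k, of e]
        has_integral_const_real[of "(e + M) / d" t 1]] by simp
  have "e * k s - (e + M) / d \<le> h s * k s" if s: "s \<in> {t..1}" for s
  proof (cases "s < t + d")
    case True
    then have "e * k s \<le> h s * k s" using near s k0[of s] by (intro mult_right_mono) auto
    moreover have "0 \<le> (e + M) / d" using e M0 d by simp
    ultimately show ?thesis by linarith
  next
    case False
    \<comment> \<open>Away from the singularity the kernel is at most 1/d for every \<open>r\<close>
      at once, because d \<le> 1. Hence the constant (e + M)/d covers both \<open>e * k s\<close>
      and the worst case \<open>- M * k s\<close> of the product.\<close>
    have "k s \<le> d powr - r"
      unfolding k_def using False d r by (intro powr_mono2') auto
    also have "\<dots> \<le> d powr - 1"
      using d r by (intro powr_mono') auto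
    also have "\<dots> = 1 / d" using d by (simp add: powr_minus_divide)
    finally have "(e + M) * k s \<le> (e + M) * (1 / d)"
      using e M0 by (intro mult_left_mono) auto
    moreover have "- M * k s \<le> h s * k s"
      using M[OF s] k0[of s] by (intro mult_right_mono) auto
    ultimately show ?thesis by (simp add: algebra_simps)
  qed
  then have "integral {t..1} (\<lambda>s. e * k s - (e + M) / d) \<le> integral {t..1} (\<lambda>s. h s * k s)"
    using lower hk by (intro integral_le) (auto simp: set_lebesgue_integral_eq_integral)
  \<comment> \<open>The integrands agree even at s = t: both are 0 there, by the conventions for
    \<open>powr\<close> at 0 and for division by 0.\<close>
  moreover have "integral {t..1} (\<lambda>s. h s * k s) = (LINT s:{t..1}|lebesgue. h s / (s - t) powr r)"
    using set_lebesgue_integral_eq_integral(2)[OF hk]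
    by (simp add: k_def powr_minus divide_inverse)
  \<comment> \<open>As 0 < 1 - t \<le> 1, lowering the exponent from 1 to 1 - r can only increase
    the power; this removes \<open>r\<close> from the factor in front of e/(1 - r).\<close>
  moreover have "(1 - t) powr 1 \<le> (1 - t) powr (1 - r)"
    using t r by (intro powr_mono') auto
  then have "e * ((1 - t) / (1 - r)) \<le> e * ((1 - t) powr (1 - r) / (1 - r))"
    using t r e by (intro mult_left_mono divide_right_mono) auto
  ultimately show ?thesis
    using integral_unique[OF lower] by (simp add: algebra_simps)
qed

lemma nonpos_if_right_RL_integral_nonpos:
  fixes h :: "real \<Rightarrow> real" and p t :: real
  assumes h: "continuous_on {t..1} h" and t: "0 \<le> t" "t < 1" and p: "0 < p" "p < 1"
    and RL: "\<And>r. r \<in> {p<..<1} \<Longrightarrow> right_RL_integral (1 - r) h t \<le> 0"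
  shows "h t \<le> 0"
proof (rule ccontr)
  assume "\<not> h t \<le> 0"
  define e where "e = h t / 2"
  have e: "0 < e" using \<open>\<not> h t \<le> 0\<close> by (simp add: e_def)
  have "bounded (h ` {t..1})"
    using h by (intro compact_imp_bounded compact_continuous_image) auto
  then obtain M where M: "\<And>s. s \<in> {t..1} \<Longrightarrow> \<bar>h s\<bar> \<le> M"
    unfolding bounded_iff real_norm_def by blast
  have M0: "0 \<le> M" using M[of t] t by auto
  obtain d0 where d0: "0 < d0" "\<And>s. s \<in> {t..1} \<Longrightarrow> dist s t < d0 \<Longrightarrow> dist (h s) (h t) < e"
    using h e t by (metis continuous_on_iff atLeastAtMost_iff order_refl less_imp_le)
  \<comment> \<open>The cap at 1 is what makes the kernel bound 1/d uniform in
    \<open>r\<close>.\<close>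
  define d where "d = min d0 1"
  have d: "0 < d" "d \<le> 1" using d0 by (auto simp: d_def)
  have near: "e \<le> h s" if "t \<le> s" "s < t + d" "s \<le> 1" for s
  proof -
    have "\<bar>h s - h t\<bar> < e"
      using d0(2)[of s] that by (simp add: d_def dist_real_def)
    then show ?thesis unfolding e_def by linarith
  qed
  \<comment> \<open>For r < 1, the condition 1 - r < e d/(e + M) says exactly that the lower bound
    (1 - t)(e/(1 - r) - (e + M)/d) is positive. The maximum with \<open>p\<close> keeps
    \<open>r\<close> in the range of \<open>RL\<close>.\<close>
  define q where "q = max p (1 - e * d / (e + M))"
  have "q < 1" using p e d M0 by (simp add: q_def)
  then obtain r where r: "q < r" "r < 1" using dense by blast
  then have r': "p < r" "1 - r < e * d / (e + M)" by (auto simp: q_def)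
  then have "(e + M) / d < e / (1 - r)"
    using e d M0 r by (simp add: field_simps)
  then have "0 < (1 - t) * (e / (1 - r) - (e + M) / d)" using t by simp
  also have "\<dots> \<le> (LINT s:{t..1}|lebesgue. h s / (s - t) powr r)"
    using h t r r' p e d near M by (intro integral_singular_kernel_ge) auto
  \<comment> \<open>Dividing by Gamma(1 - r) > 0 preserves the sign.\<close>
  finally have "0 < right_RL_integral (1 - r) h t"
    using r by (simp add: right_RL_integral_def Gamma_real_pos)
  with RL[of r] r r' show False by simp
qed

lemma right_RL_integral_uminus:
  "right_RL_integral \<mu> (\<lambda>s. - h s) t = - right_RL_integral \<mu> h t"
  by (simp add: right_RL_integral_def set_lebesgue_integral_def)

text \<open>At interior points of [0,1] the relative filter is the full one, so the one-sided
  convention of \<open>deriv_unit\<close> only matters at 0 and 1.\<close>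

lemma C1_unit_imp_DERIV:
  assumes "C1_unit f" "0 < x" "x < 1"
  shows "(f has_real_derivative deriv_unit f x) (at x)"
proof -
  have "f differentiable (at x within {0..1})"
    using assms by (auto simp: C1_unit_def differentiable_on_def)
  then have "(f has_vector_derivative deriv_unit f x) (at x within {0..1})"
    by (simp add: deriv_unit_def vector_derivative_works)
  moreover have "at x within {0..1} = at x"
    using assms by (intro at_within_interior) auto
  ultimately show ?thesis by (simp add: has_real_derivative_iff_has_vector_derivative)
qed

theorem theorem1:
  fixes f :: "real \<Rightarrow> real" and p :: real
  assumes "C1_unit f"
    and "p \<in> {0<..<1}"
  shows "((\<forall>t\<in>{0..1}. \<forall>r\<in>{p<..<1}. right_Caputo_deriv r f t \<ge> 0) \<longrightarrow> antimono_on {0..1} f) \<and>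
         ((\<forall>t\<in>{0..1}. \<forall>r\<in>{p<..<1}. right_Caputo_deriv r f t \<le> 0) \<longrightarrow> mono_on {0..1} f)"
proof (intro conjI impI)
  have cont_f: "continuous_on {a..b} f" if "0 \<le> a" "b \<le> 1" for a b
    using assms(1) that continuous_on_subset[OF differentiable_imp_continuous_on, of f "{0..1}" "{a..b}"]
    by (auto simp: C1_unit_def)
  have cont_f': "continuous_on {t..1} (deriv_unit f)" if "0 \<le> t" for t
    using assms(1) that continuous_on_subset[of "{0..1}" "deriv_unit f" "{t..1}"]
    by (auto simp: C1_unit_def)
  {
    assume C: "\<forall>t\<in>{0..1}. \<forall>r\<in>{p<..<1}. right_Caputo_deriv r f t \<ge> 0"
    \<comment> \<open>The minus sign in the Caputo derivative turns \<open>C\<close> into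
      nonpositivity of the fractional integral of f'. Open-interval information suffices, since
      continuity carries monotonicity to the endpoints.\<close>
    have nonpos: "deriv_unit f t \<le> 0" if "0 < t" "t < 1" for t
      using C that assms(2) cont_f'[of t]
      by (intro nonpos_if_right_RL_integral_nonpos[of t "deriv_unit f" p]) (auto simp: right_Caputo_deriv_def)
    have "f b \<le> f a" if "0 \<le> a" "a \<le> b" "b \<le> 1" for a b
    proof (rule DERIV_nonpos_imp_decreasing_open[OF that(2)])
      show "\<exists>y. (f has_real_derivative y) (at x) \<and> y \<le> 0" if "a < x" "x < b" for x
        using C1_unit_imp_DERIV[OF assms(1), of x] nonpos[of x] that \<open>0 \<le> a\<close> \<open>b \<le> 1\<close>
        by fastforce
    qed (use cont_f that in auto)
    then show "antimono_on {0..1} f" by (auto simp: monotone_on_def)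
  next
    assume C: "\<forall>t\<in>{0..1}. \<forall>r\<in>{p<..<1}. right_Caputo_deriv r f t \<le> 0"
    have nonneg: "0 \<le> deriv_unit f t" if "0 < t" "t < 1" for t
    proof -
      have "- deriv_unit f t \<le> 0"
        using C that assms(2) cont_f'[of t]
        by (intro nonpos_if_right_RL_integral_nonpos[of t "\<lambda>s. - deriv_unit f s" p])
          (auto simp: right_Caputo_deriv_def right_RL_integral_uminus intro: continuous_on_minus)
      then show ?thesis by simp
    qed
    have "f a \<le> f b" if "0 \<le> a" "a \<le> b" "b \<le> 1" for a b
    proof (rule DERIV_nonneg_imp_increasing_open[OF that(2)])
      show "\<exists>y. (f has_real_derivative y) (at x) \<and> 0 \<le> y" if "a < x" "x < b" for x
        using C1_unit_imp_DERIV[OF assms(1), of x] nonneg[of x] that \<open>0 \<le> a\<close> \<open>b \<le> 1\<close>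
        by fastforce
    qed (use cont_f that in auto)
    then show "mono_on {0..1} f" by (auto simp: monotone_on_def)
  }
qed

end
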